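(* Let $(G,T)$ be a bipartite graft with color classes $A$ and $B$, let $F$ be a minimum join of $(G,T)$, and let $X\subseteq A$ be a maximal bipartitic extreme set of $(G,T)$. Let $(G',T')$ be a graft obtained from $(G,T)$ by fringe removal or by fringe addition with respect to $X$. Then: (i) a set of edges is a minimum join of $(G',T')$ if and only if it is a minimum join of $(G,T)$; (ii) for every $y\in D_X$, $\min_{x\in X}\lambda_{(G,T),F}(x,y)=\min_{x\in X}\lambda_{(G',T'),F}(x,y)$; (iii) $X$ is a maximal bipartitic extreme set of $(G',T')$.
   Context: All graphs are finite (parallel edges allowed). A graft is a pair $(G,T)$ with $T\subseteq V(G)$; a join is $F\subseteq E(G)$ such that each vertex is incident to an odd number of edges of $F$ iff it lies in $T$; a minimum join is one of minimum size. A bipartite graft has $G$ bipartite with given color classes. For $F\subseteq E$ and a subgraph $Q$, $w_F(Q)=|E(Q)\setminus F|-|E(Q)\cap F|$; $\lambda_{(G,T),F}(x,y)$ is the minimum of $w_F(P)$ over paths $P$ of $G$ between $x$ and $y$ ($0$ if $x=y$); for a minimum join $F$ it does not depend on the choice of $F$. A set $X$ is extreme if $\lambda_{(G,T),F}(x,y)\ge0$ for all $x,y\in X$ ($F$ a minimum join). An extreme set is bipartitic if contained in one color class; maximal bipartitic extreme means not properly contained in another bipartitic extreme set. $D_X:=\{y\in V(G)\setminus X:\min_{x\in X}\lambda_{(G,T),F}(x,y)<0\}$ and $C_X:=V(G)\setminus X\setminus D_X$. Fringe removal: deleting from $(G,T)$ all vertices of $C_X$ (i.e. $G'=G-C_X$,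 $T'=T\setminus C_X$). Fringe addition: adding new vertices and new edges each joining a new vertex to a vertex of $X$ (with $T'=T$). *)

theory Defs
  imports "HOL-Library.Extended_Real"
begin

text \<open>
  Finite undirected multigraphs: edges are objects of their own with an assigned set of ends,
  so parallel edges are distinct edges with equal \<open>ends\<close>. Graphs are nonempty, as usual.
  Loops are excluded; they cannot occur in bipartite graphs, the only ones considered.
\<close>

record ('v, 'e) mgraph =
  verts :: "'v set"
  edges :: "'e set"
  ends :: "'e \<Rightarrow> 'v set"

definition multigraph :: "('v, 'e) mgraph \<Rightarrow> bool" where
  "multigraph G \<longleftrightarrow>
     finite (verts G) \<and> verts G \<noteq> {} \<and> finite (edges G) \<and>
     (\<forall>e\<in>edges G. ends G e \<subseteq> verts G \<and> card (ends G e) = 2)"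

definition graft :: "('v, 'e) mgraph \<Rightarrow> 'v set \<Rightarrow> bool" where
  "graft G T \<longleftrightarrow> multigraph G \<and> T \<subseteq> verts G"

definition color_classes :: "('v, 'e) mgraph \<Rightarrow> 'v set \<Rightarrow> 'v set \<Rightarrow> bool" where
  "color_classes G A B \<longleftrightarrow>
     A \<union> B = verts G \<and> A \<inter> B = {} \<and>
     (\<forall>e\<in>edges G. \<exists>a\<in>A. \<exists>b\<in>B. ends G e = {a, b})"

definition bipartite_graft :: "('v, 'e) mgraph \<Rightarrow> 'v set \<Rightarrow> 'v set \<Rightarrow> 'v set \<Rightarrow> bool" where
  "bipartite_graft G T A B \<longleftrightarrow> graft G T \<and> color_classes G A B"

definition join :: "('v, 'e) mgraph \<Rightarrow> 'v set \<Rightarrow> 'e set \<Rightarrow> bool" where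
  "join G T F \<longleftrightarrow>
     F \<subseteq> edges G \<and> (\<forall>v\<in>verts G. odd (card {e \<in> F. v \<in> ends G e}) \<longleftrightarrow> v \<in> T)"

definition min_join :: "('v, 'e) mgraph \<Rightarrow> 'v set \<Rightarrow> 'e set \<Rightarrow> bool" where
  "min_join G T F \<longleftrightarrow> join G T F \<and> (\<forall>F'. join G T F' \<longrightarrow> card F \<le> card F')"

text \<open>A path is given by its vertex sequence \<open>vs\<close> and its edge sequence \<open>es\<close>.\<close>

definition path_between ::
  "('v, 'e) mgraph \<Rightarrow> 'v \<Rightarrow> 'v list \<Rightarrow> 'e list \<Rightarrow> 'v \<Rightarrow> bool" where
  "path_between G x vs es y \<longleftrightarrow>
     length vs = Suc (length es) \<and> hd vs = x \<and> last vs = y \<and>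
     distinct vs \<and> set vs \<subseteq> verts G \<and> set es \<subseteq> edges G \<and>
     (\<forall>i<length es. ends G (es ! i) = {vs ! i, vs ! Suc i})"

definition weight :: "'e set \<Rightarrow> 'e set \<Rightarrow> int" where
  "weight F Q = int (card (Q - F)) - int (card (Q \<inter> F))"

text \<open>
  The minimum is an infimum in the extended reals: it is attained if a path exists, and is
  \<open>\<infinity>\<close> if \<open>x\<close> and \<open>y\<close> lie in different components. The set \<open>T\<close> enters only
  through the join \<open>F\<close>.
\<close>

definition lambda :: "('v, 'e) mgraph \<Rightarrow> 'e set \<Rightarrow> 'v \<Rightarrow> 'v \<Rightarrow> ereal" where
  "lambda G F x y =
     (if x = y then 0
      else INF es \<in> {es. \<exists>vs. path_between G x vs es y}. ereal (of_int (weight F (set es))))"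

text \<open>
  For a minimum join \<open>F\<close> the value \<open>lambda G F x y\<close> does not depend on \<open>F\<close>, so for grafts
  that have a join the quantifier over \<open>F\<close> may equally be read universally.
\<close>

definition extreme :: "('v, 'e) mgraph \<Rightarrow> 'v set \<Rightarrow> 'v set \<Rightarrow> bool" where
  "extreme G T X \<longleftrightarrow>
     X \<subseteq> verts G \<and> (\<exists>F. min_join G T F \<and> (\<forall>x\<in>X. \<forall>y\<in>X. lambda G F x y \<ge> 0))"

definition bipartitic_extreme ::
  "('v, 'e) mgraph \<Rightarrow> 'v set \<Rightarrow> 'v set \<Rightarrow> 'v set \<Rightarrow> 'v set \<Rightarrow> bool" where
  "bipartitic_extreme G T A B X \<longleftrightarrow> extreme G T X \<and> (X \<subseteq> A \<or> X \<subseteq> B)"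

definition max_bipartitic_extreme ::
  "('v, 'e) mgraph \<Rightarrow> 'v set \<Rightarrow> 'v set \<Rightarrow> 'v set \<Rightarrow> 'v set \<Rightarrow> bool" where
  "max_bipartitic_extreme G T A B X \<longleftrightarrow>
     bipartitic_extreme G T A B X \<and> \<not> (\<exists>Y. X \<subset> Y \<and> bipartitic_extreme G T A B Y)"

definition D_set :: "('v, 'e) mgraph \<Rightarrow> 'e set \<Rightarrow> 'v set \<Rightarrow> 'v set" where
  "D_set G F X = {y \<in> verts G - X. (INF x\<in>X. lambda G F x y) < 0}"

definition C_set :: "('v, 'e) mgraph \<Rightarrow> 'e set \<Rightarrow> 'v set \<Rightarrow> 'v set" where
  "C_set G F X = verts G - X - D_set G F X"

definition delete_verts :: "('v, 'e) mgraph \<Rightarrow> 'v set \<Rightarrow> ('v, 'e) mgraph" where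
  "delete_verts G S =
     \<lparr>verts = verts G - S, edges = {e \<in> edges G. ends G e \<inter> S = {}}, ends = ends G\<rparr>"

definition fringe_removal ::
  "('v, 'e) mgraph \<Rightarrow> 'v set \<Rightarrow> 'e set \<Rightarrow> 'v set \<Rightarrow> ('v, 'e) mgraph \<Rightarrow> 'v set \<Rightarrow> bool" where
  "fringe_removal G T F X G' T' \<longleftrightarrow>
     G' = delete_verts G (C_set G F X) \<and> T' = T - C_set G F X"

definition fringe_addition ::
  "('v, 'e) mgraph \<Rightarrow> 'v set \<Rightarrow> 'v set \<Rightarrow> ('v, 'e) mgraph \<Rightarrow> 'v set \<Rightarrow> bool" where
  "fringe_addition G T X G' T' \<longleftrightarrow>
     verts G \<subseteq> verts G' \<and> finite (verts G') \<and>
     edges G \<subseteq> edges G' \<and> finite (edges G') \<and>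
     (\<forall>e\<in>edges G. ends G' e = ends G e) \<and>
     (\<forall>e\<in>edges G' - edges G. \<exists>v\<in>verts G' - verts G. \<exists>x\<in>X. ends G' e = {v, x}) \<and>
     T' = T"

text \<open>
  The color classes of the modified graft when \<open>X \<subseteq> A\<close>: old vertices keep their class, and
  the vertices added by a fringe addition, whose neighbours all lie in \<open>X\<close>, join the class
  opposite to \<open>A\<close> (also when they are isolated).
\<close>

definition fringe_A :: "('v, 'e) mgraph \<Rightarrow> 'v set \<Rightarrow> 'v set" where
  "fringe_A G' A = A \<inter> verts G'"

definition fringe_B :: "('v, 'e) mgraph \<Rightarrow> 'v set \<Rightarrow> 'v set" where
  "fringe_B G' A = verts G' - A"

end

theory Submission
  imports Defs
begin

text \<open>
  For a minimum join \<open>F\<close>, taking symmetric differences with \<open>F\<close> shows that \<open>lambda G F x y\<close> is the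
  least \<open>F\<close>-weight of an \<open>{x, y}\<close>-join, so most path surgery can be replaced by the arithmetic of
  joins. In particular, if \<open>X\<close> is extreme, then every \<open>U\<close>-join with \<open>U \<subseteq> X\<close> has nonnegative weight,
  because it splits into paths between vertices of \<open>X\<close> and an even edge set.

  Edges added at a fringe meet the old vertices only in \<open>X\<close>. Dropping them from a join of the larger
  graph therefore changes its terminals only inside \<open>X\<close>, which by the above is never paid for by a
  decrease in weight; this gives all claims for fringe addition. If \<open>X\<close> is maximal, then, by parity
  in the bipartite graph, the vertices of \<open>C_set G F X\<close> have all their neighbours in \<open>X\<close> and are not
  touched by \<open>F\<close>. So \<open>G\<close> arises from the fringe removal by a fringe addition, and the removal case
  is the addition case read backwards.
\<close>

section \<open>Joins and weights\<close>

lemma card_sym_diff: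
  assumes "finite A" "finite B"
  shows "card (sym_diff A B) + 2 * card (A \<inter> B) = card A + card B"
proof -
  have "card A = card (A - B) + card (A \<inter> B)" "card B = card (B - A) + card (A \<inter> B)"
    using assms by (metis add.commute card_Int_Diff inf_commute)+
  moreover have "card (sym_diff A B) = card (A - B) + card (B - A)"
    using assms by (intro card_Un_disjoint) auto
  ultimately show ?thesis by simp
qed

lemma odd_card_sym_diff:
  assumes "finite A" "finite B"
  shows "odd (card (sym_diff A B)) \<longleftrightarrow> odd (card A) \<noteq> odd (card B)"
  using card_sym_diff[OF assms] by presburger

text \<open>Incidence sets at a vertex also combine by symmetric difference, so degree parities, and
  with them the terminal sets, add modulo 2.\<close>

lemma join_sym_diff:
  assumes "join G S K" "join G S' K'" "finite K" "finite K'"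
  shows "join G (sym_diff S S') (sym_diff K K')"
proof -
  have *: "{e \<in> sym_diff K K'. v \<in> ends G e} =
      sym_diff {e \<in> K. v \<in> ends G e} {e \<in> K'. v \<in> ends G e}" for v
    by blast
  have "odd (card {e \<in> sym_diff K K'. v \<in> ends G e}) \<longleftrightarrow>
      odd (card {e \<in> K. v \<in> ends G e}) \<noteq> odd (card {e \<in> K'. v \<in> ends G e})" for v
    unfolding * by (rule odd_card_sym_diff) (use assms(3,4) in auto)
  then show ?thesis
    using assms(1,2) unfolding join_def by blast
qed

lemma join_finite: "join G S K \<Longrightarrow> multigraph G \<Longrightarrow> finite K"
  unfolding join_def multigraph_def by (blast intro: finite_subset)

lemma join_edge:
  assumes "e \<in> edges G" "ends G e = {x, y}" "x \<noteq> y"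
  shows "join G (sym_diff {x} {y}) {e}"
proof -
  have "{e' \<in> {e}. v \<in> ends G e'} = (if v = x \<or> v = y then {e} else {})" for v
    using assms(2) by auto
  then show ?thesis
    using assms unfolding join_def by auto
qed

text \<open>The weight is the change in size when \<open>F\<close> is replaced by
  \<open>sym_diff F K\<close>. This identity translates between minimality of joins and signs of
  weights.\<close>

lemma card_sym_diff_weight:
  assumes "finite F" "finite K"
  shows "int (card (sym_diff F K)) = int (card F) + weight F K"
proof -
  have "card K = card (K - F) + card (K \<inter> F)"
    using assms(2) by (metis add.commute card_Int_Diff)
  then show ?thesis
    using card_sym_diff[OF assms] by (simp add: weight_def Int_commute)
qed

lemma weight_Un_disjoint:
  assumes "finite K" "finite L" "K \<inter> L = {}"
  shows "weight F (K \<union> L) = weight F K + weight F L"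
proof -
  have "card ((K \<union> L) - F) = card (K - F) + card (L - F)"
    unfolding Un_Diff using assms by (intro card_Un_disjoint) auto
  moreover have "card ((K \<union> L) \<inter> F) = card (K \<inter> F) + card (L \<inter> F)"
    unfolding Int_Un_distrib2 using assms by (intro card_Un_disjoint) auto
  ultimately show ?thesis by (simp add: weight_def)
qed

lemma weight_subset:
  assumes "finite K" "P \<subseteq> K"
  shows "weight F K = weight F P + weight F (K - P)"
  using weight_Un_disjoint[of P "K - P" F] assms finite_subset[OF assms(2,1)]
  by (simp add: Un_absorb1)

text \<open>Toggling one edge changes the size of \<open>sym_diff F K\<close> by exactly one, so the
  bound needs no case distinction on \<open>e\<close> lying in \<open>F\<close> or in
  \<open>K\<close>.\<close>

lemma weight_sym_diff_edge:
  assumes "finite F" "finite K"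
  shows "weight F (sym_diff K {e}) \<le> weight F K + 1"
proof -
  have "sym_diff F (sym_diff K {e}) = sym_diff (sym_diff F K) {e}"
    by blast
  then have "card (sym_diff F (sym_diff K {e})) \<le> card (sym_diff F K) + 1"
    using card_sym_diff[of "sym_diff F K" "{e}"] assms by simp
  then show ?thesis
    using card_sym_diff_weight[of F K] card_sym_diff_weight[of F "sym_diff K {e}"] assms
    by simp
qed

text \<open>Toggling an even edge set in \<open>F\<close> gives another \<open>T\<close>-join, which
  cannot be smaller than \<open>F\<close>.\<close>

lemma min_join_weight:
  assumes "multigraph G" "min_join G T F" "join G {} K"
  shows "0 \<le> weight F K"
proof -
  have fin: "finite F" "finite K" and F: "join G T F"
    using assms join_finite unfolding min_join_def by blast+
  have "join G T (sym_diff F K)"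
    using join_sym_diff[OF F assms(3) fin] by simp
  then have "card F \<le> card (sym_diff F K)"
    using assms(2) unfolding min_join_def by blast
  then show ?thesis
    using card_sym_diff_weight[OF fin] by simp
qed

text \<open>Every edge has exactly one end in \<open>B\<close>, so \<open>card K\<close> is the sum
  of the \<open>K\<close>-degrees over \<open>B\<close>, and all of these are even.\<close>

lemma join_even_card:
  assumes "multigraph G" "color_classes G A B" "join G S K" "S \<inter> B = {}"
  shows "even (card K)"
proof -
  have fin: "finite K" "finite B"
    using assms(1,2) join_finite[OF assms(3,1)]
    unfolding multigraph_def color_classes_def by (auto intro: finite_subset)
  have col: "\<exists>a\<in>A. \<exists>b\<in>B. ends G e = {a, b}" if "e \<in> K" for e
    using assms(2,3) that unfolding color_classes_def join_def by blast
  have AB: "A \<inter> B = {}"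
    using assms(2) unfolding color_classes_def by blast
  have "K = (\<Union>b\<in>B. {e \<in> K. b \<in> ends G e})"
    using col by blast
  moreover have "card (\<Union>b\<in>B. {e \<in> K. b \<in> ends G e}) =
      (\<Sum>b\<in>B. card {e \<in> K. b \<in> ends G e})"
  proof (rule card_UN_disjoint)
    show "\<forall>i\<in>B. \<forall>j\<in>B. i \<noteq> j \<longrightarrow> {e \<in> K. i \<in> ends G e} \<inter> {e \<in> K. j \<in> ends G e} = {}"
    proof (intro ballI impI equals0I)
      fix i j e
      assume ij: "i \<in> B" "j \<in> B" "i \<noteq> j" and "e \<in> {e \<in> K. i \<in> ends G e} \<inter> {e \<in> K. j \<in> ends G e}"
      then have e: "e \<in> K" "i \<in> ends G e" "j \<in> ends G e"
        by auto
      then obtain a b where "a \<in> A" "b \<in> B" "ends G e = {a, b}"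
        using col by blast
      then show False
        using e ij AB by auto
    qed
  qed (use fin in auto)
  moreover have "even (card {e \<in> K. b \<in> ends G e})" if "b \<in> B" for b
    using assms(2-4) that unfolding join_def color_classes_def by blast
  ultimately show ?thesis
    by (metis (mono_tags, lifting) dvd_sum)
qed

section \<open>Paths\<close>

lemma path_between_self: "x \<in> verts G \<Longrightarrow> path_between G x [x] [] x"
  unfolding path_between_def by simp

lemma path_between_Cons:
  assumes "path_between G z vs es y" "e \<in> edges G" "ends G e = {x, z}" "x \<notin> set vs" "x \<in> verts G"
  shows "path_between G x (x # vs) (e # es) y"
proof -
  have "vs \<noteq> []" "hd vs = z"
    using assms(1) unfolding path_between_def by auto
  then have "vs ! 0 = z"
    by (simp add: hd_conv_nth)
  have "ends G ((e # es) ! i) = {(x # vs) ! i, (x # vs) ! Suc i}" if "i < length (e # es)" for i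
    using assms(1,3) that \<open>vs ! 0 = z\<close> unfolding path_between_def by (cases i) auto
  then show ?thesis
    using assms \<open>vs \<noteq> []\<close> unfolding path_between_def by auto
qed

lemma path_between_ConsD:
  assumes "path_between G x vs (e # es) y"
  obtains z vs' where "vs = x # vs'" "path_between G z vs' es y" "e \<in> edges G"
    "ends G e = {x, z}" "x \<notin> set vs'" "x \<in> verts G"
proof -
  from assms obtain z ws where vs: "vs = x # z # ws"
    unfolding path_between_def by (cases vs; cases "tl vs") auto
  have nth: "ends G ((e # es) ! i) = {vs ! i, vs ! Suc i}" if "i < length (e # es)" for i
    using assms that unfolding path_between_def by blast
  have "ends G (es ! i) = {(z # ws) ! i, (z # ws) ! Suc i}" if "i < length es" for i
    using nth[of "Suc i"] that vs by simp
  then have "path_between G z (z # ws) es y"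
    using assms vs unfolding path_between_def by auto
  moreover have "ends G e = {x, z}"
    using nth[of 0] vs by simp
  ultimately show ?thesis
    using assms vs that[of "z # ws" z] unfolding path_between_def by auto
qed

lemma path_between_drop:
  assumes "path_between G x vs es y" "z \<in> set vs"
  shows "\<exists>vs' es'. path_between G z vs' es' y \<and> set es' \<subseteq> set es"
  using assms
proof (induction es arbitrary: x vs)
  case Nil
  then have "vs = [x]" "z = x"
    unfolding path_between_def by (cases vs; auto)+
  then show ?case
    using Nil by auto
next
  case (Cons e es)
  obtain w vs' where *: "vs = x # vs'" "path_between G w vs' es y"
    by (rule path_between_ConsD[OF Cons.prems(1)])
  show ?case
  proof (cases "z = x")
    case True
    then show ?thesis
      using Cons.prems(1) by blast
  next
    case False
    then show ?thesis
      using Cons.IH[OF *(2)] Cons.prems(2) * by auto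
  qed
qed

lemma path_edges_ends:
  assumes "path_between G x vs es y" "e \<in> set es"
  shows "ends G e \<subseteq> set vs"
proof -
  obtain i where "i < length es" "e = es ! i"
    using assms(2) by (metis in_set_conv_nth)
  then show ?thesis
    using assms(1) unfolding path_between_def by simp
qed

lemma path_join:
  assumes "path_between G x vs es y"
  shows "join G (sym_diff {x} {y}) (set es)"
  using assms
proof (induction es arbitrary: x vs)
  case Nil
  then have "x = y"
    unfolding path_between_def by (cases vs) auto
  then show ?case
    unfolding join_def by simp
next
  case (Cons e es)
  obtain z vs' where *: "vs = x # vs'" "path_between G z vs' es y" "e \<in> edges G"
      "ends G e = {x, z}" "x \<notin> set vs'" "x \<in> verts G"
    by (rule path_between_ConsD[OF Cons.prems])
  have "z \<in> set vs'"
    using *(2) unfolding path_between_def by (cases vs') auto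
  then have "x \<noteq> z"
    using *(5) by blast
  have "e \<notin> set es"
    using path_edges_ends[OF *(2)] *(4,5) by blast
  then have "sym_diff {e} (set es) = set (e # es)"
    by auto
  moreover have "sym_diff (sym_diff {x} {z}) (sym_diff {z} {y}) = sym_diff {x} {y}"
    using \<open>x \<noteq> z\<close> by blast
  ultimately show ?case
    using join_sym_diff[OF join_edge[OF *(3,4) \<open>x \<noteq> z\<close>] Cons.IH[OF *(2)]] by simp
qed

text \<open>Induction on \<open>card K\<close>. Deleting an edge \<open>e\<close> from
  \<open>x\<close> to \<open>z\<close> flips the parity at exactly these two vertices. Either
  \<open>z\<close> is odd in \<open>K\<close> and the path is \<open>e\<close> alone, or
  \<open>z\<close> is odd in \<open>K - {e}\<close> and the induction hypothesis continues the path
  from there.\<close>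

lemma odd_vertex_path:
  assumes "multigraph G" "K \<subseteq> edges G" "x \<in> verts G" "odd (card {e \<in> K. x \<in> ends G e})"
  shows "\<exists>y vs es. y \<noteq> x \<and> odd (card {e \<in> K. y \<in> ends G e}) \<and>
           path_between G x vs es y \<and> set es \<subseteq> K"
  using assms(2-4)
proof (induction "card K" arbitrary: K x rule: less_induct)
  case less
  have finK: "finite K"
    using assms(1) less.prems(1) unfolding multigraph_def by (blast intro: finite_subset)
  have "{e \<in> K. x \<in> ends G e} \<noteq> {}"
    using less.prems(3) by (metis card.empty even_zero)
  then obtain e where e: "e \<in> K" "x \<in> ends G e"
    by blast
  have "ends G e \<subseteq> verts G" "card (ends G e) = 2"
    using assms(1) less.prems(1) e(1) unfolding multigraph_def by blast+
  then obtain z where z: "ends G e = {x, z}" "z \<noteq> x" "z \<in> verts G"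
    using e(2) unfolding card_2_iff by (metis insertE insert_commute insert_subset singletonD)
  have eG: "e \<in> edges G"
    using e less.prems(1) by blast
  have deg: "odd (card {e' \<in> K - {e}. v \<in> ends G e'}) \<longleftrightarrow>
      odd (card {e' \<in> K. v \<in> ends G e'}) \<noteq> (v = x \<or> v = z)" for v
  proof -
    have "{e' \<in> K - {e}. v \<in> ends G e'} =
        sym_diff {e' \<in> K. v \<in> ends G e'} (if v = x \<or> v = z then {e} else {})"
      using e(1) z(1) by auto
    moreover have "odd (card (sym_diff {e' \<in> K. v \<in> ends G e'} (if v = x \<or> v = z then {e} else {})))
        \<longleftrightarrow> odd (card {e' \<in> K. v \<in> ends G e'}) \<noteq> odd (card (if v = x \<or> v = z then {e} else {}))"
      by (rule odd_card_sym_diff) (use finK in auto)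
    ultimately show ?thesis
      by auto
  qed
  show ?case
  proof (cases "odd (card {e' \<in> K. z \<in> ends G e'})")
    case True
    have "path_between G x [x, z] [e] z"
      using path_between_Cons[OF path_between_self[OF z(3)] eG z(1) _ less.prems(2)] z(2) by simp
    then show ?thesis
      using True z(2) e(1) by (intro exI[of _ z] exI[of _ "[x, z]"] exI[of _ "[e]"]) auto
  next
    case False
    have "card (K - {e}) < card K"
      using finK e(1) by (rule card_Diff1_less)
    moreover have "odd (card {e' \<in> K - {e}. z \<in> ends G e'})"
      using False deg[of z] by simp
    ultimately obtain y vs es where y: "y \<noteq> z" "odd (card {e' \<in> K - {e}. y \<in> ends G e'})"
        "path_between G z vs es y" "set es \<subseteq> K - {e}"
      using less.hyps[of "K - {e}" z] less.prems(1) z(3) by blast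
    \<comment> \<open>The deletion has made \<open>x\<close> even, so the path found from
      \<open>z\<close> cannot end in \<open>x\<close>.\<close>
    have "\<not> odd (card {e' \<in> K - {e}. x \<in> ends G e'})"
      using deg[of x] less.prems(3) by simp
    then have "y \<noteq> x"
      using y(2) by blast
    then have oddy: "odd (card {e' \<in> K. y \<in> ends G e'})"
      using deg[of y] y(1,2) by simp
    \<comment> \<open>Prepending \<open>e\<close> is possible only if the path from \<open>z\<close>
      avoids \<open>x\<close>; otherwise its tail starting at \<open>x\<close> is already the
      required path.\<close>
    have "\<exists>vs' es'. path_between G x vs' es' y \<and> set es' \<subseteq> K"
    proof (cases "x \<in> set vs")
      case True
      then show ?thesis
        using path_between_drop[OF y(3)] y(4) by blast
    next
      case False
      then show ?thesis
        using path_between_Cons[OF y(3) eG z(1) False less.prems(2)] y(4) e(1)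
        by (intro exI[of _ "x # vs"] exI[of _ "e # es"]) auto
    qed
    then show ?thesis
      using \<open>y \<noteq> x\<close> oddy by blast
  qed
qed

text \<open>Splits one path off a join. The rest is again a join, with two terminals fewer, which
  allows induction on the terminal set.\<close>

lemma join_path:
  assumes "multigraph G" "join G S K" "x \<in> S" "x \<in> verts G"
  obtains y vs es where "y \<noteq> x" "y \<in> S" "y \<in> verts G" "path_between G x vs es y" "set es \<subseteq> K"
    "join G (S - {x, y}) (K - set es)"
proof -
  have "odd (card {e \<in> K. x \<in> ends G e})" "K \<subseteq> edges G"
    using assms(2-4) unfolding join_def by auto
  then obtain y vs es where y: "y \<noteq> x" "odd (card {e \<in> K. y \<in> ends G e})"
      "path_between G x vs es y" "set es \<subseteq> K"
    using odd_vertex_path[OF assms(1) _ assms(4)] by blast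
  have yV: "y \<in> verts G"
    using y(3) unfolding path_between_def by (cases vs rule: rev_cases) auto
  then have yS: "y \<in> S"
    using y(2) assms(2) unfolding join_def by blast
  have "sym_diff S (sym_diff {x} {y}) = S - {x, y}" "sym_diff K (set es) = K - set es"
    using assms(3) yS y(1,4) by blast+
  then have "join G (S - {x, y}) (K - set es)"
    using join_sym_diff[OF assms(2) path_join[OF y(3)] join_finite[OF assms(2,1)]] by simp
  with y yV yS that show ?thesis
    by blast
qed

section \<open>Distances\<close>

lemma lambda_le_path:
  assumes "path_between G x vs es y" "x \<noteq> y"
  shows "lambda G F x y \<le> ereal (of_int (weight F (set es)))"
  using assms unfolding lambda_def by (auto intro: INF_lower)

text \<open>The join contains a path from \<open>x\<close>, which can only end in the other terminal
  \<open>y\<close>. The remaining edges form an even set, whose weight is nonnegative. Together with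
  \<open>lambda_greatest\<close> this makes \<open>lambda\<close> the least weight of a join with
  terminals \<open>x\<close> and \<open>y\<close>.\<close>

lemma lambda_le_join:
  assumes "multigraph G" "min_join G T F" "x \<in> verts G" "join G (sym_diff {x} {y}) K"
  shows "lambda G F x y \<le> ereal (of_int (weight F K))"
proof (cases "x = y")
  case True
  then show ?thesis
    using min_join_weight[OF assms(1,2)] assms(4) by (simp add: lambda_def)
next
  case False
  then have "x \<in> sym_diff {x} {y}"
    by blast
  then obtain z vs es where z: "z \<noteq> x" "z \<in> sym_diff {x} {y}" "path_between G x vs es z"
      "set es \<subseteq> K" "join G (sym_diff {x} {y} - {x, z}) (K - set es)"
    using join_path[OF assms(1,4) _ assms(3)] by metis
  have "z = y"
    using z(1,2) by blast
  moreover have "join G {} (K - set es)"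
  proof -
    have "sym_diff {x} {y} - {x, z} = {}"
      using \<open>z = y\<close> by blast
    then show ?thesis
      using z(5) by (simp only:)
  qed
  then have "weight F (set es) \<le> weight F K"
    using min_join_weight[OF assms(1,2)] weight_subset[OF join_finite[OF assms(4,1)] z(4), of F]
    by fastforce
  then have "ereal (of_int (weight F (set es))) \<le> ereal (of_int (weight F K))"
    by simp
  ultimately show ?thesis
    using lambda_le_path[OF z(3), of F] z(1) order_trans by blast
qed

lemma lambda_greatest:
  assumes "\<And>K. join G (sym_diff {x} {y}) K \<Longrightarrow> c \<le> ereal (of_int (weight F K))"
  shows "c \<le> lambda G F x y"
proof (cases "x = y")
  case True
  \<comment> \<open>For equal ends the empty join has weight 0, which is the value
    \<open>lambda\<close> is given by definition.\<close>
  have "join G (sym_diff {x} {y}) {}"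
    using True unfolding join_def by simp
  then show ?thesis
    using assms[of "{}"] True by (simp add: lambda_def weight_def zero_ereal_def)
next
  case False
  then show ?thesis
    unfolding lambda_def by (auto intro!: INF_greatest assms dest: path_join)
qed

lemma lambda_neg_join:
  assumes "lambda G F x y < 0"
  obtains K where "join G (sym_diff {x} {y}) K" "weight F K < 0"
  using lambda_greatest[of G x y 0 F] assms that
  by (metis ereal_less_eq(5) linorder_not_le of_int_0_le_iff)

lemma lambda_commute_nonneg:
  assumes "multigraph G" "min_join G T F" "x \<in> verts G" "0 \<le> lambda G F x y"
  shows "0 \<le> lambda G F y x"
proof (rule lambda_greatest)
  fix K
  assume "join G (sym_diff {y} {x}) K"
  then have "join G (sym_diff {x} {y}) K"
    by (simp add: Un_commute)
  then show "0 \<le> ereal (of_int (weight F K))"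
    using lambda_le_join[OF assms(1-3)] assms(4) order_trans by blast
qed

text \<open>The map from \<open>K\<close> to \<open>sym_diff F (sym_diff J K)\<close> preserves the
  terminals, since those of \<open>F\<close> and \<open>J\<close> cancel. It turns the
  \<open>J\<close>-weight into the \<open>F\<close>-weight because both joins have the same size.
  Exchanging \<open>F\<close> and \<open>J\<close> gives equality.\<close>

lemma lambda_min_join_le:
  assumes "multigraph G" "min_join G T F" "min_join G T J" "x \<in> verts G"
  shows "lambda G F x y \<le> lambda G J x y"
proof (rule lambda_greatest)
  fix K
  assume K: "join G (sym_diff {x} {y}) K"
  have F: "join G T F" and J: "join G T J" and card: "card F = card J"
    using assms(2,3) unfolding min_join_def by (auto intro: order_antisym)
  have fin: "finite F" "finite J" "finite K"
    using F J K join_finite assms(1) by blast+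
  let ?L = "sym_diff F (sym_diff J K)"
  have "join G (sym_diff T (sym_diff T (sym_diff {x} {y}))) ?L"
    by (intro join_sym_diff F J K) (use fin in auto)
  moreover have "sym_diff T (sym_diff T (sym_diff {x} {y})) = sym_diff {x} {y}"
    by blast
  ultimately have "lambda G F x y \<le> ereal (of_int (weight F ?L))"
    using lambda_le_join[OF assms(1,2,4)] by simp
  moreover have "sym_diff F ?L = sym_diff J K"
    by blast
  then have "weight F ?L = weight J K"
    using card_sym_diff_weight[of F ?L] card_sym_diff_weight[of J K] fin card by simp
  ultimately show "lambda G F x y \<le> ereal (of_int (weight J K))"
    by simp
qed

section \<open>Extreme sets and joins with terminals in them\<close>

text \<open>The definition of \<open>extreme\<close> only provides some minimum join; independence
  of the choice carries the bound over to the given \<open>F\<close>.\<close>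

lemma extreme_lambda:
  assumes "multigraph G" "min_join G T F" "extreme G T X" "x \<in> X" "y \<in> X"
  shows "0 \<le> lambda G F x y"
proof -
  obtain J where "min_join G T J" "0 \<le> lambda G J x y" "x \<in> verts G"
    using assms(3-5) unfolding extreme_def by blast
  then show ?thesis
    using lambda_min_join_le[OF assms(1) _ assms(2)] order_trans by blast
qed

text \<open>The way in which maximality is contradicted later. Distances from \<open>a\<close> back
  to \<open>X\<close> are covered by symmetry.\<close>

lemma extreme_insert:
  assumes "multigraph G" "min_join G T F" "extreme G T X" "a \<in> verts G"
    and "\<And>x. x \<in> X \<Longrightarrow> 0 \<le> lambda G F x a"
  shows "extreme G T (insert a X)"
proof -
  have X: "X \<subseteq> verts G"
    using assms(3) unfolding extreme_def by blast
  have "0 \<le> lambda G F x y" if "x \<in> insert a X" "y \<in> insert a X" for x y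
  proof (cases "x = y")
    case False
    then show ?thesis
      using that assms(5) lambda_commute_nonneg[OF assms(1,2)] X extreme_lambda[OF assms(1-3)]
      by blast
  qed (simp add: lambda_def)
  then show ?thesis
    using assms(2,4) X unfolding extreme_def by blast
qed

text \<open>Induction on the terminal set: a path between two terminals is nonnegative because
  \<open>X\<close> is extreme, and the rest is a join with two terminals fewer. The base case is an
  even edge set.\<close>

lemma extreme_join_weight:
  assumes "multigraph G" "min_join G T F" "extreme G T X" "U \<subseteq> X" "join G U K"
  shows "0 \<le> weight F K"
proof -
  have X: "X \<subseteq> verts G"
    using assms(3) unfolding extreme_def by blast
  have "finite U"
    using X assms(1,4) unfolding multigraph_def by (blast intro: finite_subset)
  then show ?thesis
    using assms(4,5)
  proof (induction U arbitrary: K rule: finite_psubset_induct)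
    case (psubset U)
    show ?case
    proof (cases "U = {}")
      case True
      then show ?thesis
        using min_join_weight[OF assms(1,2)] psubset.prems(2) by blast
    next
      case False
      then obtain x where x: "x \<in> U"
        by blast
      then have "x \<in> verts G"
        using psubset.prems(1) X by blast
      with x obtain y vs es where y: "y \<noteq> x" "y \<in> U" "path_between G x vs es y" "set es \<subseteq> K"
          "join G (U - {x, y}) (K - set es)"
        using join_path[OF assms(1) psubset.prems(2)] by metis
      have "0 \<le> lambda G F x y"
        using extreme_lambda[OF assms(1-3)] x y(2) psubset.prems(1) by blast
      then have "0 \<le> weight F (set es)"
        using lambda_le_path[OF y(3), of F] y(1)
        by (metis ereal_less_eq(5) of_int_0_le_iff order_trans)
      moreover have "0 \<le> weight F (K - set es)"
        using psubset.IH[OF _ _ y(5)] x psubset.prems(1) by blast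
      ultimately show ?thesis
        using weight_subset[OF join_finite[OF psubset.prems(2) assms(1)] y(4), of F] by simp
    qed
  qed
qed

text \<open>The path split off at \<open>y\<close> ends in some \<open>u\<close> of
  \<open>X\<close>. What is left has all its terminals in \<open>X\<close>, so removing it does not
  increase the weight.\<close>

lemma extreme_join_lambda:
  assumes "multigraph G" "min_join G T F" "extreme G T X" "U \<subseteq> X" "y \<in> verts G - X"
    and "join G (insert y U) K"
  shows "\<exists>u\<in>X. lambda G F u y \<le> ereal (of_int (weight F K))"
proof -
  obtain u vs es where u: "u \<noteq> y" "u \<in> insert y U" "u \<in> verts G" "path_between G y vs es u"
      "set es \<subseteq> K" "join G (insert y U - {y, u}) (K - set es)"
    using join_path[OF assms(1,6)] assms(5) by (metis DiffD1 insertI1)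
  have uX: "u \<in> X"
    using u(1,2) assms(4) by blast
  have "0 \<le> weight F (K - set es)"
    using extreme_join_weight[OF assms(1-3) _ u(6)] assms(4) by blast
  then have "ereal (of_int (weight F (set es))) \<le> ereal (of_int (weight F K))"
    using weight_subset[OF join_finite[OF assms(6,1)] u(5), of F] by simp
  moreover have "join G (sym_diff {u} {y}) (set es)"
    using path_join[OF u(4)] by (simp add: Un_commute)
  then have "lambda G F u y \<le> ereal (of_int (weight F (set es)))"
    using lambda_le_join[OF assms(1,2) u(3)] by blast
  ultimately show ?thesis
    using uX order_trans by blast
qed

section \<open>Fringe addition\<close>

lemma fringe_addition_multigraph:
  assumes "fringe_addition G T X G' T'" "multigraph G" "X \<subseteq> verts G"
  shows "multigraph G'"
proof -
  have V: "verts G \<subseteq> verts G'" "finite (verts G')" "finite (edges G')"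
    and old: "\<And>e. e \<in> edges G \<Longrightarrow> ends G' e = ends G e"
    and new: "\<And>e. e \<in> edges G' - edges G \<Longrightarrow>
      \<exists>v\<in>verts G' - verts G. \<exists>x\<in>X. ends G' e = {v, x}"
    using assms(1) unfolding fringe_addition_def by simp_all
  have G: "verts G \<noteq> {}" "\<And>e. e \<in> edges G \<Longrightarrow> ends G e \<subseteq> verts G \<and> card (ends G e) = 2"
    using assms(2) unfolding multigraph_def by simp_all
  have "ends G' e \<subseteq> verts G' \<and> card (ends G' e) = 2" if e: "e \<in> edges G'" for e
  proof (cases "e \<in> edges G")
    case True
    then show ?thesis
      using old G(2)[OF True] V(1) by auto
  next
    case False
    then obtain v x where vx: "v \<in> verts G' - verts G" "x \<in> X" "ends G' e = {v, x}"
      using new[of e] e by blast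
    then have "v \<noteq> x" "x \<in> verts G'"
      using assms(3) V(1) by blast+
    then show ?thesis
      using vx by simp
  qed
  then show ?thesis
    using V G(1) unfolding multigraph_def by blast
qed

lemma join_fringe_addition:
  assumes "fringe_addition G T X G' T'" "multigraph G" "join G S K" "S \<subseteq> verts G"
  shows "join G' S K"
proof -
  have K: "K \<subseteq> edges G" "K \<subseteq> edges G'" "\<And>e. e \<in> K \<Longrightarrow> ends G' e = ends G e"
    using assms(1,3) unfolding join_def fringe_addition_def by auto
  have "odd (card {e \<in> K. v \<in> ends G' e}) \<longleftrightarrow> v \<in> S" for v
  proof (cases "v \<in> verts G")
    case True
    have "{e \<in> K. v \<in> ends G' e} = {e \<in> K. v \<in> ends G e}"
      using K(3) by auto
    then show ?thesis
      using True assms(3) unfolding join_def by simp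
  next
    case False
    then have empty: "{e \<in> K. v \<in> ends G' e} = {}"
      using K(1,3) assms(2) unfolding multigraph_def by auto
    show ?thesis
      using False assms(4) unfolding empty by auto
  qed
  then show ?thesis
    using K(2) unfolding join_def by blast
qed

text \<open>Dropping the new edges of \<open>K\<close> changes the parity only at old vertices that
  meet an odd number of them, and a new edge meets the old vertices only in
  \<open>X\<close>.\<close>

lemma join_fringe_restrict:
  assumes "fringe_addition G T X G' T'" "X \<subseteq> verts G" "join G' S K"
  obtains U where "U \<subseteq> X" "join G (sym_diff S U) (K \<inter> edges G)"
proof -
  define U where "U = {v \<in> verts G. odd (card {e \<in> K - edges G. v \<in> ends G' e})}"
  have K: "K \<subseteq> edges G'"
    using assms(3) unfolding join_def by blast
  then have finK: "finite K"
    using assms(1) unfolding fringe_addition_def by (blast intro: finite_subset)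
  have "v \<in> X" if "v \<in> U" for v
  proof -
    have "v \<in> verts G" "{e \<in> K - edges G. v \<in> ends G' e} \<noteq> {}"
      using that unfolding U_def by (auto dest: odd_pos simp del: Collect_empty_eq)
    then obtain e where e: "e \<in> K - edges G" "v \<in> ends G' e"
      by blast
    then obtain w x where "w \<in> verts G' - verts G" "x \<in> X" "ends G' e = {w, x}"
      using K assms(1) unfolding fringe_addition_def by blast
    then show ?thesis
      using e(2) \<open>v \<in> verts G\<close> by auto
  qed
  moreover have "odd (card {e \<in> K \<inter> edges G. v \<in> ends G e}) \<longleftrightarrow> v \<in> sym_diff S U"
    if v: "v \<in> verts G" for v
  proof -
    have eq: "{e \<in> K \<inter> edges G. v \<in> ends G e} =
        sym_diff {e \<in> K. v \<in> ends G' e} {e \<in> K - edges G. v \<in> ends G' e}"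
      using assms(1) unfolding fringe_addition_def by auto
    have "odd (card {e \<in> K \<inter> edges G. v \<in> ends G e}) \<longleftrightarrow>
        odd (card {e \<in> K. v \<in> ends G' e}) \<noteq> odd (card {e \<in> K - edges G. v \<in> ends G' e})"
      unfolding eq by (rule odd_card_sym_diff) (use finK in auto)
    moreover have "v \<in> verts G'"
      using v assms(1) unfolding fringe_addition_def by blast
    ultimately show ?thesis
      using assms(3) v unfolding join_def U_def by auto
  qed
  ultimately show ?thesis
    using that[of U] unfolding join_def by blast
qed

lemma weight_fringe_restrict:
  assumes "fringe_addition G T X G' T'" "join G' S K" "F \<subseteq> edges G"
  shows "weight F (K \<inter> edges G) \<le> weight F K"
proof -
  have finK: "finite K"
    using assms(1,2) unfolding join_def fringe_addition_def by (blast intro: finite_subset)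
  have "(K - K \<inter> edges G) \<inter> F = {}"
    using assms(3) by blast
  then have "0 \<le> weight F (K - K \<inter> edges G)"
    unfolding weight_def by simp
  then show ?thesis
    using weight_subset[OF finK, of "K \<inter> edges G" F] by simp
qed

text \<open>The old part of \<open>J\<close> differs from \<open>F\<close> by a join whose terminals
  lie in \<open>X\<close>. Its weight is nonnegative, so the old part alone has at least
  \<open>card F\<close> edges. The extra summand shows that a minimum join cannot contain new
  edges.\<close>

lemma fringe_addition_join_card:
  assumes "fringe_addition G T X G' T'" "multigraph G" "min_join G T F" "extreme G T X"
    and "join G' T J"
  shows "card F + card (J - edges G) \<le> card J"
proof -
  have X: "X \<subseteq> verts G"
    using assms(4) unfolding extreme_def by blast
  have F: "join G T F"
    using assms(3) unfolding min_join_def by blast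
  obtain U where U: "U \<subseteq> X" "join G (sym_diff T U) (J \<inter> edges G)"
    by (rule join_fringe_restrict[OF assms(1) X assms(5)])
  let ?J = "J \<inter> edges G"
  have fin: "finite F" "finite ?J" "finite J"
    using join_finite F U(2) assms(1,2,5)
    unfolding join_def fringe_addition_def by (blast intro: finite_subset)+
  have "sym_diff T (sym_diff T U) = U"
    by blast
  then have "join G U (sym_diff F ?J)"
    using join_sym_diff[OF F U(2) fin(1,2)] by simp
  then have "0 \<le> weight F (sym_diff F ?J)"
    using extreme_join_weight[OF assms(2-4) U(1)] by blast
  moreover have "sym_diff F (sym_diff F ?J) = ?J"
    by blast
  ultimately have "card F \<le> card ?J"
    using card_sym_diff_weight[of F "sym_diff F ?J"] fin by simp
  then show ?thesis
    using card_Int_Diff[OF fin(3), of "edges G"] by simp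
qed

lemma fringe_addition_min_join_iff:
  assumes "fringe_addition G T X G' T'" "graft G T" "min_join G T F" "extreme G T X"
  shows "min_join G' T J \<longleftrightarrow> min_join G T J"
proof -
  have G: "multigraph G" and T: "T \<subseteq> verts G"
    using assms(2) unfolding graft_def by auto
  note up = join_fringe_addition[OF assms(1) G _ T]
  note card = fringe_addition_join_card[OF assms(1) G assms(3,4)]
  have F: "join G T F" "\<And>J. join G T J \<Longrightarrow> card F \<le> card J"
    using assms(3) unfolding min_join_def by auto
  show ?thesis
  proof
    assume J: "min_join G' T J"
    then have J': "join G' T J" "card J \<le> card F"
      using up[OF F(1)] unfolding min_join_def by auto
    have "finite (J - edges G)"
      using J'(1) assms(1) unfolding join_def fringe_addition_def by (blast intro: finite_subset)
    moreover have "card (J - edges G) = 0"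
      using card[OF J'(1)] J'(2) by linarith
    ultimately have "J \<subseteq> edges G"
      by simp
    moreover have "{e \<in> J. v \<in> ends G' e} = {e \<in> J. v \<in> ends G e}" for v
      using assms(1) \<open>J \<subseteq> edges G\<close> unfolding fringe_addition_def by auto
    ultimately have "join G T J"
      using J'(1) assms(1) unfolding join_def fringe_addition_def by auto
    then show "min_join G T J"
      using J'(2) F(2) unfolding min_join_def by (meson order_trans)
  next
    assume J: "min_join G T J"
    have "card J \<le> card L" if "join G' T L" for L
      using card[OF that] J F(1) unfolding min_join_def by (meson add_leD1 order_trans)
    then show "min_join G' T J"
      using up J unfolding min_join_def by blast
  qed
qed

lemma fringe_addition_lambda_le:
  assumes "fringe_addition G T X G' T'"
  shows "lambda G' F x y \<le> lambda G F x y"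
proof -
  have "path_between G' x vs es y" if p: "path_between G x vs es y" for vs es
  proof -
    have "ends G' (es ! i) = ends G (es ! i)" if "i < length es" for i
      using p assms that unfolding path_between_def fringe_addition_def
      by (meson nth_mem subset_iff)
    then show ?thesis
      using p assms unfolding path_between_def fringe_addition_def by auto
  qed
  then show ?thesis
    unfolding lambda_def by (auto intro!: INF_superset_mono)
qed

text \<open>Restricting a join to the old edges may replace the terminal \<open>x\<close> by other
  vertices of \<open>X\<close>. This is why infima over \<open>X\<close> are compared, and not the
  distances from a single \<open>x\<close>.\<close>

lemma fringe_addition_Inf_lambda:
  assumes "fringe_addition G T X G' T'" "multigraph G" "min_join G T F" "extreme G T X"
    and "y \<in> verts G - X"
  shows "(INF x\<in>X. lambda G F x y) = (INF x\<in>X. lambda G' F x y)"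
proof (rule antisym)
  have X: "X \<subseteq> verts G"
    using assms(4) unfolding extreme_def by blast
  have F: "F \<subseteq> edges G"
    using assms(3) unfolding min_join_def join_def by blast
  show "(INF x\<in>X. lambda G F x y) \<le> (INF x\<in>X. lambda G' F x y)"
  proof (intro INF_greatest lambda_greatest)
    fix x K
    assume x: "x \<in> X" and K: "join G' (sym_diff {x} {y}) K"
    obtain U where U: "U \<subseteq> X" "join G (sym_diff (sym_diff {x} {y}) U) (K \<inter> edges G)"
      by (rule join_fringe_restrict[OF assms(1) X K])
    \<comment> \<open>As \<open>y\<close> is outside \<open>X\<close>, it is not in \<open>U\<close>
      and remains a terminal; all other terminals are in \<open>X\<close>.\<close>
    have "sym_diff (sym_diff {x} {y}) U = insert y (sym_diff {x} U)"
      using U(1) x assms(5) by blast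
    then have "join G (insert y (sym_diff {x} U)) (K \<inter> edges G)" "sym_diff {x} U \<subseteq> X"
      using U x by auto
    then obtain u where "u \<in> X" "lambda G F u y \<le> ereal (of_int (weight F (K \<inter> edges G)))"
      using extreme_join_lambda[OF assms(2-4) _ assms(5)] by blast
    moreover have "ereal (of_int (weight F (K \<inter> edges G))) \<le> ereal (of_int (weight F K))"
      using weight_fringe_restrict[OF assms(1) K F] by simp
    ultimately show "(INF x\<in>X. lambda G F x y) \<le> ereal (of_int (weight F K))"
      by (meson INF_lower2 order_trans)
  qed
  show "(INF x\<in>X. lambda G' F x y) \<le> (INF x\<in>X. lambda G F x y)"
    by (intro INF_mono) (use fringe_addition_lambda_le[OF assms(1)] in blast)
qed

text \<open>After restriction to the old edges, a join between two vertices of \<open>X\<close>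
  still has all its terminals in \<open>X\<close>.\<close>

lemma fringe_addition_extreme:
  assumes "fringe_addition G T X G' T'" "graft G T" "min_join G T F" "extreme G T X"
  shows "extreme G' T X"
proof -
  have G: "multigraph G"
    using assms(2) unfolding graft_def by blast
  have X: "X \<subseteq> verts G"
    using assms(4) unfolding extreme_def by blast
  have F: "F \<subseteq> edges G"
    using assms(3) unfolding min_join_def join_def by blast
  have "0 \<le> lambda G' F x y" if xy: "x \<in> X" "y \<in> X" for x y
  proof (rule lambda_greatest)
    fix K
    assume K: "join G' (sym_diff {x} {y}) K"
    obtain U where U: "U \<subseteq> X" "join G (sym_diff (sym_diff {x} {y}) U) (K \<inter> edges G)"
      by (rule join_fringe_restrict[OF assms(1) X K])
    have "sym_diff (sym_diff {x} {y}) U \<subseteq> X"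
      using U(1) xy by blast
    then have "0 \<le> weight F (K \<inter> edges G)"
      using extreme_join_weight[OF G assms(3,4) _ U(2)] by blast
    then show "0 \<le> ereal (of_int (weight F K))"
      using weight_fringe_restrict[OF assms(1) K F] by simp
  qed
  moreover have "min_join G' T F"
    using fringe_addition_min_join_iff[OF assms] assms(3) by blast
  moreover have "X \<subseteq> verts G'"
    using X assms(1) unfolding fringe_addition_def by blast
  ultimately show ?thesis
    unfolding extreme_def by blast
qed

section \<open>Fringe removal\<close>

text \<open>By maximality every vertex of \<open>A\<close> outside \<open>X\<close> is at negative
  distance from \<open>X\<close>, so \<open>c\<close> lies in \<open>B\<close> and its neighbour
  \<open>a\<close> in \<open>A\<close>. If \<open>a\<close> were outside \<open>X\<close>, a
  negative join from \<open>X\<close> to \<open>a\<close> could be extended by \<open>e\<close> to a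
  negative join to \<open>c\<close>. If \<open>a\<close> is in \<open>X\<close>, then
  \<open>e\<close> in \<open>F\<close> would itself give distance -1.\<close>

lemma C_set_edge:
  assumes "bipartite_graft G T A B" "min_join G T F" "X \<subseteq> A"
    and "max_bipartitic_extreme G T A B X"
    and "e \<in> edges G" "c \<in> C_set G F X" "c \<in> ends G e"
  shows "e \<notin> F" "\<exists>x\<in>X. ends G e = {c, x}"
proof -
  have G: "multigraph G" and col: "color_classes G A B"
    using assms(1) unfolding bipartite_graft_def graft_def by auto
  have AB: "A \<union> B = verts G" "A \<inter> B = {}"
    using col unfolding color_classes_def by auto
  have ext: "extreme G T X"
    using assms(4) unfolding max_bipartitic_extreme_def bipartitic_extreme_def by blast
  have XV: "X \<subseteq> verts G"
    using ext unfolding extreme_def by blast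
  have neg: "\<exists>x\<in>X. lambda G F x a < 0" if "a \<in> A - X" for a
  proof (rule ccontr)
    assume "\<not> ?thesis"
    then have "extreme G T (insert a X)"
      using that AB(1) by (intro extreme_insert[OF G assms(2) ext]) (auto simp: not_less)
    moreover have "insert a X \<subseteq> A" "X \<subset> insert a X"
      using that assms(3) by auto
    ultimately show False
      using assms(4) unfolding max_bipartitic_extreme_def bipartitic_extreme_def by blast
  qed
  have c: "c \<in> verts G" "c \<notin> X" "\<And>x. x \<in> X \<Longrightarrow> 0 \<le> lambda G F x c"
    using assms(6) unfolding C_set_def D_set_def by (auto simp: not_less le_INF_iff)
  then have "c \<notin> A"
    using neg by fastforce
  obtain a b where ab: "a \<in> A" "b \<in> B" "ends G e = {a, b}"
    using col assms(5) unfolding color_classes_def by blast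
  then have "b = c" "a \<noteq> c"
    using assms(7) \<open>c \<notin> A\<close> by auto
  have ends: "ends G e = {a, c}"
    using ab \<open>b = c\<close> by blast
  note ac = join_edge[OF assms(5) ends \<open>a \<noteq> c\<close>]
  have finF: "finite F"
    using assms(2) join_finite[OF _ G] unfolding min_join_def by blast
  have aX: "a \<in> X"
  proof (rule ccontr)
    assume "a \<notin> X"
    then obtain x where x: "x \<in> X" "lambda G F x a < 0"
      using neg ab(1) by blast
    obtain K where K: "join G (sym_diff {x} {a}) K" "weight F K < 0"
      using lambda_neg_join[OF x(2)] by blast
    have finK: "finite K"
      using join_finite[OF K(1) G] .
    \<comment> \<open>Both terminals lie in \<open>A\<close>, so the weight of \<open>K\<close> is
      even and hence at most -2. It stays negative when one more edge is toggled.\<close>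
    have "even (card K)"
      by (rule join_even_card[OF G col K(1)]) (use x(1) assms(3) ab(1) AB(2) in auto)
    moreover have "card K = card (K - F) + card (K \<inter> F)"
      using card_Int_Diff[OF finK, of F] by simp
    ultimately have "weight F K \<noteq> -1"
      unfolding weight_def by presburger
    then have "weight F (sym_diff K {e}) < 0"
      using weight_sym_diff_edge[OF finF finK, of e] K(2) by linarith
    then have "ereal (of_int (weight F (sym_diff K {e}))) < 0"
      by simp
    moreover have "sym_diff (sym_diff {x} {a}) (sym_diff {a} {c}) = sym_diff {x} {c}"
      using \<open>a \<noteq> c\<close> x(1) \<open>a \<notin> X\<close> by blast
    then have "join G (sym_diff {x} {c}) (sym_diff K {e})"
      using join_sym_diff[OF K(1) ac finK] by simp
    then have "lambda G F x c \<le> ereal (of_int (weight F (sym_diff K {e})))"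
      using lambda_le_join[OF G assms(2)] x(1) XV by blast
    ultimately show False
      using c(3)[OF x(1)] by (meson leD order.trans)
  qed
  then show "\<exists>x\<in>X. ends G e = {c, x}"
    using ends by (auto simp: insert_commute)
  show "e \<notin> F"
  proof
    assume "e \<in> F"
    then have "ereal (of_int (weight F {e})) < 0"
      unfolding weight_def by simp
    moreover have "lambda G F a c \<le> ereal (of_int (weight F {e}))"
      using lambda_le_join[OF G assms(2) _ ac] aX XV by blast
    ultimately show False
      using c(3)[OF aX] by (meson leD order.trans)
  qed
qed

text \<open>No edge of \<open>F\<close> meets a vertex of \<open>C_set G F X\<close>, so its
  \<open>F\<close>-degree is zero. Thus fringe removal leaves \<open>T\<close> unchanged.\<close>

lemma C_set_terminals:
  assumes "bipartite_graft G T A B" "min_join G T F" "X \<subseteq> A"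
    and "max_bipartitic_extreme G T A B X"
  shows "T \<inter> C_set G F X = {}"
proof (rule equals0I)
  fix c
  assume "c \<in> T \<inter> C_set G F X"
  then have c: "c \<in> T" "c \<in> C_set G F X" "c \<in> verts G"
    unfolding C_set_def by auto
  have F: "F \<subseteq> edges G" "odd (card {e \<in> F. c \<in> ends G e})"
    using assms(2) c(1,3) unfolding min_join_def join_def by auto
  have "{e \<in> F. c \<in> ends G e} = {}"
    using C_set_edge(1)[OF assms _ c(2)] F(1) by blast
  with F(2) show False
    by (metis card.empty even_zero)
qed

lemma fringe_removal_addition:
  assumes "bipartite_graft G T A B" "min_join G T F" "X \<subseteq> A"
    and "max_bipartitic_extreme G T A B X"
  shows "fringe_addition (delete_verts G (C_set G F X)) T X G T"
proof -
  have "finite (verts G)" "finite (edges G)"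
    using assms(1) unfolding bipartite_graft_def graft_def multigraph_def by auto
  moreover have "\<exists>v\<in>C_set G F X. \<exists>x\<in>X. ends G e = {v, x}"
    if "e \<in> edges G" "ends G e \<inter> C_set G F X \<noteq> {}" for e
    using C_set_edge(2)[OF assms that(1)] that(2) by blast
  moreover have "verts G - (verts G - C_set G F X) = C_set G F X"
    unfolding C_set_def by blast
  ultimately show ?thesis
    unfolding fringe_addition_def delete_verts_def by simp
qed

section \<open>Maximality in the modified graft\<close>

text \<open>Every singleton is bipartitic extreme. Nonemptiness ties supersets of \<open>X\<close>
  to the class \<open>A\<close> and guarantees that a vertex survives fringe removal.\<close>

lemma max_bipartitic_extreme_nonempty:
  assumes "bipartite_graft G T A B" "min_join G T F" "max_bipartitic_extreme G T A B X"
  shows "X \<noteq> {}"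
proof
  assume "X = {}"
  obtain v where v: "v \<in> verts G"
    using assms(1) unfolding bipartite_graft_def graft_def multigraph_def by blast
  have "extreme G T {v}"
    using assms(2) v unfolding extreme_def by (auto simp: lambda_def)
  moreover have "v \<in> A \<or> v \<in> B"
    using assms(1) v unfolding bipartite_graft_def color_classes_def by blast
  ultimately have "bipartitic_extreme G T A B {v}" "X \<subset> {v}"
    using \<open>X = {}\<close> unfolding bipartitic_extreme_def by auto
  then show False
    using assms(3) unfolding max_bipartitic_extreme_def by blast
qed

text \<open>A vertex that could be added to \<open>X\<close> in \<open>G'\<close> could also be
  added in \<open>G\<close>, because the infima over \<open>X\<close> agree. Assuming this agreement
  for the vertices of class \<open>A\<close> lets the lemma serve both fringe operations.\<close>

lemma max_bipartitic_extreme_transfer: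
  assumes "bipartite_graft G T A B" "min_join G T F" "X \<subseteq> A"
    and "max_bipartitic_extreme G T A B X"
    and "multigraph G'" "min_join G' T F" "extreme G' T X" "fringe_A G' A \<subseteq> verts G"
    and Inf: "\<And>y. y \<in> fringe_A G' A - X \<Longrightarrow>
      (INF x\<in>X. lambda G F x y) = (INF x\<in>X. lambda G' F x y)"
  shows "max_bipartitic_extreme G' T (fringe_A G' A) (fringe_B G' A) X"
proof -
  have G: "multigraph G"
    using assms(1) unfolding bipartite_graft_def graft_def by blast
  have ext: "extreme G T X"
    using assms(4) unfolding max_bipartitic_extreme_def bipartitic_extreme_def by blast
  have XA: "X \<subseteq> fringe_A G' A"
    using assms(3,7) unfolding fringe_A_def extreme_def by blast
  have False if Y: "X \<subset> Y" "bipartitic_extreme G' T (fringe_A G' A) (fringe_B G' A) Y" for Y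
  proof -
    \<comment> \<open>\<open>X\<close> is nonempty and inside \<open>A\<close>, so no superset of it
      fits into the other class.\<close>
    have "\<not> Y \<subseteq> fringe_B G' A"
      using Y(1) assms(3) max_bipartitic_extreme_nonempty[OF assms(1,2,4)]
      unfolding fringe_B_def by blast
    then have YA: "Y \<subseteq> fringe_A G' A" and Yext: "extreme G' T Y"
      using Y(2) unfolding bipartitic_extreme_def by auto
    obtain a where a: "a \<in> Y" "a \<notin> X"
      using Y(1) by blast
    have "0 \<le> (INF x\<in>X. lambda G' F x a)"
      using extreme_lambda[OF assms(5,6) Yext _ a(1)] Y(1) by (intro INF_greatest) blast
    also have "\<dots> = (INF x\<in>X. lambda G F x a)"
      using Inf a YA by (metis DiffI subsetD)
    finally have "extreme G T (insert a X)"
      using a(1) YA assms(8) by (intro extreme_insert[OF G assms(2) ext]) (auto simp: le_INF_iff)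
    moreover have "insert a X \<subseteq> A"
      using a(1) YA assms(3) unfolding fringe_A_def by blast
    ultimately have "bipartitic_extreme G T A B (insert a X)" "X \<subset> insert a X"
      using a(2) unfolding bipartitic_extreme_def by auto
    then show False
      using assms(4) unfolding max_bipartitic_extreme_def by blast
  qed
  then show ?thesis
    using assms(7) XA unfolding max_bipartitic_extreme_def bipartitic_extreme_def by blast
qed

theorem theorem6p6:
  fixes G G' :: "('v, 'e) mgraph"
    and T T' A B X :: "'v set"
    and F :: "'e set"
  assumes "bipartite_graft G T A B"
    and "min_join G T F"
    and "X \<subseteq> A"
    and "max_bipartitic_extreme G T A B X"
    and "fringe_removal G T F X G' T' \<or> fringe_addition G T X G' T'"
  shows "(\<forall>J. min_join G' T' J \<longleftrightarrow> min_join G T J) \<and>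
         (\<forall>y\<in>D_set G F X. (INF x\<in>X. lambda G F x y) = (INF x\<in>X. lambda G' F x y)) \<and>
         max_bipartitic_extreme G' T' (fringe_A G' A) (fringe_B G' A) X"
proof -
  have graft: "graft G T" and G: "multigraph G" and TV: "T \<subseteq> verts G" and AV: "A \<subseteq> verts G"
    using assms(1) unfolding bipartite_graft_def graft_def color_classes_def by auto
  have ext: "extreme G T X"
    using assms(4) unfolding max_bipartitic_extreme_def bipartitic_extreme_def by blast
  have XV: "X \<subseteq> verts G"
    using ext unfolding extreme_def by blast
  have DV: "D_set G F X \<subseteq> verts G - X" "D_set G F X \<inter> C_set G F X = {}"
    unfolding D_set_def C_set_def by auto
  from assms(5) show ?thesis
  proof
    assume add: "fringe_addition G T X G' T'"
    then have T': "T' = T"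
      unfolding fringe_addition_def by blast
    note iff = fringe_addition_min_join_iff[OF add graft assms(2) ext]
    note Inf = fringe_addition_Inf_lambda[OF add G assms(2) ext]
    have "min_join G' T F"
      using iff assms(2) by blast
    \<comment> \<open>Added vertices never enter the class of \<open>A\<close>, since
      \<open>A\<close> consists of old vertices.\<close>
    moreover have "fringe_A G' A \<subseteq> verts G"
      using AV unfolding fringe_A_def by blast
    ultimately have "max_bipartitic_extreme G' T (fringe_A G' A) (fringe_B G' A) X"
      using fringe_addition_multigraph[OF add G XV] fringe_addition_extreme[OF add graft assms(2) ext] Inf
      by (intro max_bipartitic_extreme_transfer[OF assms(1-4)]) auto
    then show ?thesis
      using iff Inf DV(1) unfolding T' by blast
  next
    assume rem: "fringe_removal G T F X G' T'"
    have TC: "T \<inter> C_set G F X = {}"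
      by (rule C_set_terminals[OF assms(1-4)])
    have G'_def: "G' = delete_verts G (C_set G F X)" and T': "T' = T"
      using rem TC unfolding fringe_removal_def by auto
    \<comment> \<open>From here \<open>G'\<close> is the smaller graph and \<open>G\<close> the
      larger one. To apply the addition lemmas, \<open>F\<close> and \<open>X\<close> must first be
      shown to be a minimum join and extreme in \<open>G'\<close>.\<close>
    have add: "fringe_addition G' T X G T"
      unfolding G'_def by (rule fringe_removal_addition[OF assms(1-4)])
    have V': "verts G' = verts G - C_set G F X" and E': "edges G' \<subseteq> edges G"
      and ends': "ends G' = ends G"
      unfolding G'_def delete_verts_def by auto
    have XV': "X \<subseteq> verts G'"
      using XV unfolding V' C_set_def by blast
    have G': "multigraph G'"
    proof -
      have "verts G' \<noteq> {}"
        using XV' max_bipartitic_extreme_nonempty[OF assms(1,2,4)] by blast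
      moreover have "finite (verts G')" "finite (edges G')"
        using G V' E' unfolding multigraph_def by (auto intro: finite_subset)
      moreover have "ends G' e \<subseteq> verts G' \<and> card (ends G' e) = 2" if "e \<in> edges G'" for e
        using that G unfolding G'_def delete_verts_def multigraph_def by auto
      ultimately show ?thesis
        unfolding multigraph_def by blast
    qed
    have graft': "graft G' T"
      using G' TV TC unfolding graft_def V' by blast
    have F: "join G T F" "\<And>J. join G T J \<Longrightarrow> card F \<le> card J"
      using assms(2) unfolding min_join_def by auto
    \<comment> \<open>Deleted edges are those at \<open>C_set G F X\<close>, and none of these is in
      \<open>F\<close>.\<close>
    have "F \<subseteq> edges G'"
      using F(1) C_set_edge(1)[OF assms(1-4)] unfolding G'_def delete_verts_def join_def by auto
    then have "join G' T F"
      using F(1) unfolding join_def ends' V' by auto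
    \<comment> \<open>Joins of \<open>G'\<close> remain joins of \<open>G\<close>, so minimality of
      \<open>F\<close> is inherited.\<close>
    moreover have "card F \<le> card J" if "join G' T J" for J
      using F(2)[OF join_fringe_addition[OF add G' that]] graft' unfolding graft_def by blast
    ultimately have F': "min_join G' T F"
      unfolding min_join_def by blast
    \<comment> \<open>Deleting vertices leaves fewer paths, so distances can only grow.\<close>
    have "0 \<le> lambda G' F x y" if "x \<in> X" "y \<in> X" for x y
      using extreme_lambda[OF G assms(2) ext that] fringe_addition_lambda_le[OF add]
      by (rule order_trans)
    then have ext': "extreme G' T X"
      using F' XV' unfolding extreme_def by blast
    note iff = fringe_addition_min_join_iff[OF add graft' F' ext']
    note Inf = fringe_addition_Inf_lambda[OF add G' F' ext', symmetric]
    have "max_bipartitic_extreme G' T (fringe_A G' A) (fringe_B G' A) X"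
      using Inf AV
      by (intro max_bipartitic_extreme_transfer[OF assms(1-4) G' F' ext']) (auto simp: fringe_A_def)
    moreover have "D_set G F X \<subseteq> verts G' - X"
      using DV unfolding V' by blast
    ultimately show ?thesis
      using iff Inf unfolding T' by blast
  qed
qed

end
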